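(* Let the random time process $Y=(Y_t)_{t\ge0}$ be a fractional Brownian motion (with continuous paths, $Y_0=0$), let $M_0$ be a Gaussian random measure on $\mathbb{R}$ with Lebesgue control measure, independent of $Y$, and let $$Y^{(-)}_t=\int_{\mathbb{R}}1_{[0,Y_t]}(x)\,M_0(dx),\qquad t\ge0.$$ For $s\ge0$ let $\tau_s=\inf\{t\ge0:Y_t=s\}$, which is almost surely finite. Then the process $(Y^{(-)}_{\tau_t})_{t\ge0}$ is a Brownian motion.
   Context: For $a<0$, $[0,a]$ means $[a,0]$. A Gaussian random measure $M_0$ on $\mathbb{R}$ with Lebesgue control measure is an independently scattered, $\sigma$-additive random set function on Borel sets of finite Lebesgue measure with $M_0(A)\sim N(0,\mathrm{Leb}(A))$. This is the case $\alpha=2$ of a symmetric $\alpha$-stable random measure, normalized so that the variance of $\int f\,dM_0$ is $\int f^2\,dx$. The integral with random kernel is defined conditionally on $Y$; equivalently $Y^{(-)}_t=X(Y_t)$, where $X(s)=M_0([0,s])$, $s\in\mathbb{R}$, is taken with continuous paths and is independent of $Y$. *)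

theory Defs
  imports "HOL-Probability.Probability"
begin

text \<open>The variance \<open>v = 0\<close> is allowed and gives a point mass;
  \<^const>\<open>normal_density\<close> takes the standard deviation, not the variance.\<close>

definition normal_rv :: "'w measure \<Rightarrow> ('w \<Rightarrow> real) \<Rightarrow> real \<Rightarrow> real \<Rightarrow> bool" where
  "normal_rv M Z m v \<longleftrightarrow>
     Z \<in> borel_measurable M \<and> 0 \<le> v \<and>
     (if v = 0 then (AE \<omega> in M. Z \<omega> = m)
      else distributed M lborel Z (normal_density m (sqrt v)))"

definition gaussian_process ::
    "'w measure \<Rightarrow> 'i set \<Rightarrow> ('i \<Rightarrow> 'w \<Rightarrow> real) \<Rightarrow> bool" where
  "gaussian_process M I Z \<longleftrightarrow>
     (\<forall>J a. finite J \<and> J \<subseteq> I \<longrightarrow>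
        (\<exists>m v. normal_rv M (\<lambda>\<omega>. \<Sum>i\<in>J. a i * Z i \<omega>) m v))"

text \<open>\<open>H\<close> is the Hurst index and \<open>c\<close> the standard deviation at time \<open>1\<close>;
  \<open>c = 1\<close> is the normalized process. Only times \<open>t \<ge> 0\<close> are constrained.\<close>

definition fractional_brownian_motion ::
    "'w measure \<Rightarrow> real \<Rightarrow> real \<Rightarrow> (real \<Rightarrow> 'w \<Rightarrow> real) \<Rightarrow> bool" where
  "fractional_brownian_motion M H c Y \<longleftrightarrow>
     0 < H \<and> H < 1 \<and> 0 < c \<and>
     gaussian_process M {0..} Y \<and>
     (\<forall>t\<ge>0. integral\<^sup>L M (Y t) = 0) \<and>
     (\<forall>s\<ge>0. \<forall>t\<ge>0. integral\<^sup>L M (\<lambda>\<omega>. Y s \<omega> * Y t \<omega>) =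
        c\<^sup>2 / 2 * (s powr (2 * H) + t powr (2 * H) - \<bar>t - s\<bar> powr (2 * H)))"

definition brownian_motion :: "'w measure \<Rightarrow> (real \<Rightarrow> 'w \<Rightarrow> real) \<Rightarrow> bool" where
  "brownian_motion M B \<longleftrightarrow>
     (\<forall>t\<ge>0. B t \<in> borel_measurable M) \<and>
     (AE \<omega> in M. B 0 \<omega> = 0) \<and>
     (\<forall>(n::nat) s. 0 \<le> s 0 \<and> (\<forall>i<n. s i < s (Suc i)) \<longrightarrow>
        prob_space.indep_vars M (\<lambda>_. borel)
          (\<lambda>i \<omega>. B (s (Suc i)) \<omega> - B (s i) \<omega>) {..<n}) \<and>
     (\<forall>s t. 0 \<le> s \<and> s < t \<longrightarrow> normal_rv M (\<lambda>\<omega>. B t \<omega> - B s \<omega>) 0 (t - s)) \<and>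
     (AE \<omega> in M. continuous_on {0..} (\<lambda>t. B t \<omega>))"

definition finite_borel :: "real set set" where
  "finite_borel = {A \<in> sets borel. emeasure lborel A < \<infinity>}"

text \<open>The random measure is a family of random variables indexed by \<^const>\<open>finite_borel\<close>;
  its values on other sets are irrelevant. As usual, \<open>\<sigma>\<close>-additivity is almost sure,
  with an exceptional null set that may depend on the sequence.\<close>

definition gaussian_random_measure ::
    "'w measure \<Rightarrow> (real set \<Rightarrow> 'w \<Rightarrow> real) \<Rightarrow> bool" where
  "gaussian_random_measure M M0 \<longleftrightarrow>
     (\<forall>A\<in>finite_borel. normal_rv M (M0 A) 0 (measure lborel A)) \<and>
     (\<forall>(n::nat) A. (\<forall>i<n. A i \<in> finite_borel) \<and> disjoint_family_on A {..<n} \<longrightarrow>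
        prob_space.indep_vars M (\<lambda>_. borel) (\<lambda>i. M0 (A i)) {..<n}) \<and>
     (\<forall>A :: nat \<Rightarrow> real set.
        (\<forall>i. A i \<in> finite_borel) \<and> disjoint_family A \<and> (\<Union>i. A i) \<in> finite_borel \<longrightarrow>
        (AE \<omega> in M. (\<lambda>i. M0 (A i) \<omega>) sums M0 (\<Union>i. A i) \<omega>))"

text \<open>Independence of the \<open>\<sigma>\<close>-algebras generated by the two whole families.\<close>

definition independent_of_process ::
    "'w measure \<Rightarrow> (real set \<Rightarrow> 'w \<Rightarrow> real) \<Rightarrow> (real \<Rightarrow> 'w \<Rightarrow> real) \<Rightarrow> bool" where
  "independent_of_process M M0 Y \<longleftrightarrow>
     prob_space.indep_set M
       (sets (vimage_algebra (space M) (\<lambda>\<omega>. \<lambda>A\<in>finite_borel. M0 A \<omega>)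
          (PiM finite_borel (\<lambda>_. borel))))
       (sets (vimage_algebra (space M) (\<lambda>\<omega>. \<lambda>t\<in>{0..}. Y t \<omega>)
          (PiM {0..} (\<lambda>_. borel))))"

text \<open>\<open>X\<close> is a version with continuous paths of \<open>s \<mapsto> M0 [0, s]\<close>, \<open>s\<close> real. For \<open>s < 0\<close>,
  \<open>closed_segment 0 s\<close> is the interval \<open>[s, 0]\<close>, and \<open>M0\<close> of it carries no minus sign.\<close>

definition continuous_version ::
    "'w measure \<Rightarrow> (real set \<Rightarrow> 'w \<Rightarrow> real) \<Rightarrow> (real \<Rightarrow> 'w \<Rightarrow> real) \<Rightarrow> bool" where
  "continuous_version M M0 X \<longleftrightarrow>
     (\<forall>s. X s \<in> borel_measurable M) \<and>
     (\<forall>s. AE \<omega> in M. X s \<omega> = M0 (closed_segment 0 s) \<omega>) \<and>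
     (\<forall>\<omega>\<in>space M. continuous_on UNIV (\<lambda>s. X s \<omega>))"

text \<open>The integral of the random kernel \<open>1\<^bsub>[0, Y\<^sub>t]\<^esub>\<close> with respect to \<open>M0\<close>, where \<open>X\<close> is
  the continuous version above.\<close>

definition random_time_process ::
    "(real \<Rightarrow> 'w \<Rightarrow> real) \<Rightarrow> (real \<Rightarrow> 'w \<Rightarrow> real) \<Rightarrow> real \<Rightarrow> 'w \<Rightarrow> real" where
  "random_time_process X Y t \<omega> = X (Y t \<omega>) \<omega>"

text \<open>Extended-real valued, so that the infimum is \<open>\<infinity>\<close> if the level is never reached.\<close>

definition hitting_time :: "(real \<Rightarrow> 'w \<Rightarrow> real) \<Rightarrow> real \<Rightarrow> 'w \<Rightarrow> ereal" where
  "hitting_time Y s \<omega> = (INF t\<in>{t. 0 \<le> t \<and> Y t \<omega> = s}. ereal t)"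

text \<open>\<^const>\<open>real_of_ereal\<close> sends \<open>\<infinity>\<close> to \<open>0\<close>; this fixes the value of the time-changed process
  where the hitting time is infinite.\<close>

definition at_hitting_times ::
    "(real \<Rightarrow> 'w \<Rightarrow> real) \<Rightarrow> (real \<Rightarrow> 'w \<Rightarrow> real) \<Rightarrow> real \<Rightarrow> 'w \<Rightarrow> real" where
  "at_hitting_times Z Y t \<omega> = Z (real_of_ereal (hitting_time Y t \<omega>)) \<omega>"

end

theory Submission
  imports Defs
begin

text \<open>
  A continuous path of \<open>Y\<close> that starts at \<open>0\<close> and is unbounded above reaches every level \<open>s \<ge> 0\<close>, and
  at the first time it does so its value is exactly \<open>s\<close>. The time-changed process is then
  \<open>X (Y \<tau>\<^sub>s) = X s\<close>, for all \<open>s \<ge> 0\<close> simultaneously. So the claim reduces to two facts.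

  The process \<open>X\<close> on \<open>{0..}\<close> is a Brownian motion, because its increments are the values of the random
  measure on disjoint intervals (\<open>continuous_version_brownian_motion\<close>). This property passes to
  processes whose paths almost surely agree with those of \<open>X\<close> at all times
  (\<open>brownian_motion_indistinguishable\<close>).

  Fractional Brownian motion is almost surely unbounded above (\<open>fbm_unbounded_above\<close>). Sampled at
  the times \<open>R, R\<^sup>2, \<dots>, R\<^sup>n\<close> and standardized, it gives \<open>n\<close> standard normal variables which
  are nearly uncorrelated when \<open>R\<close> is large (\<open>fbm_correlation_le\<close>), while a fixed upper bound on the path
  becomes a bound close to \<open>0\<close> on all of them. By a second moment estimate this has
  probability \<open>O(1 / n)\<close> (\<open>prob_all_normal_le_small\<close>). The estimate is applied to
  \<open>x + (1 - cos x)\<close>, which has positive mean under the standard normal law, is at most \<open>0\<close> on the negative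
  half-line, and has covariances that can be read off from characteristic functions.
\<close>

section \<open>Normal random variables\<close>

lemma normal_rv_AE_cong:
  assumes "normal_rv M Z m v" and "Z' \<in> borel_measurable M"
    and "AE \<omega> in M. Z' \<omega> = Z \<omega>"
  shows "normal_rv M Z' m v"
proof (cases "v = 0")
  case True
  then have "AE \<omega> in M. Z \<omega> = m"
    using assms(1) by (simp add: normal_rv_def)
  with assms(3) have "AE \<omega> in M. Z' \<omega> = m"
    by eventually_elim simp
  with True assms(2) show ?thesis
    by (simp add: normal_rv_def)
next
  case False
  have "distr M lborel Z' = distr M lborel Z"
    using assms by (intro distr_cong_AE) (auto simp: normal_rv_def)
  with False assms(1,2) show ?thesis
    by (simp add: normal_rv_def distributed_def)
qed

lemma (in prob_space) normal_rv_moments: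
  assumes "normal_rv M Z m v"
  shows "integrable M Z" and "integrable M (\<lambda>\<omega>. (Z \<omega>)\<^sup>2)"
    and "expectation Z = m" and "expectation (\<lambda>\<omega>. (Z \<omega>)\<^sup>2) = v + m\<^sup>2"
proof -
  have Z[measurable]: "Z \<in> borel_measurable M" and "0 \<le> v"
    using assms by (auto simp: normal_rv_def)
  have "integrable M Z \<and> integrable M (\<lambda>\<omega>. (Z \<omega>)\<^sup>2) \<and> expectation Z = m
      \<and> expectation (\<lambda>\<omega>. (Z \<omega>)\<^sup>2) = v + m\<^sup>2"
  proof (cases "v = 0")
    case True
    then have AE: "AE \<omega> in M. Z \<omega> = m"
      using assms by (simp add: normal_rv_def)
    then have AE2: "AE \<omega> in M. (Z \<omega>)\<^sup>2 = m\<^sup>2"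
      by eventually_elim simp
    have "integrable M Z"
      by (subst integrable_cong_AE[OF _ _ AE]) auto
    moreover have "integrable M (\<lambda>\<omega>. (Z \<omega>)\<^sup>2)"
      by (subst integrable_cong_AE[OF _ _ AE2]) auto
    moreover have "expectation Z = m"
      by (subst integral_cong_AE[OF _ _ AE]) (auto simp: prob_space)
    moreover have "expectation (\<lambda>\<omega>. (Z \<omega>)\<^sup>2) = m\<^sup>2"
      by (subst integral_cong_AE[OF _ _ AE2]) (auto simp: prob_space)
    ultimately show ?thesis
      using True by simp
  next
    case False
    with \<open>0 \<le> v\<close> have pos: "0 < sqrt v" and D: "distributed M lborel Z (normal_density m (sqrt v))"
      using assms by (auto simp: normal_rv_def)
    have E: "expectation Z = m"
      using normal_distributed_expectation[OF pos D] .
    have iZ: "integrable M Z"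
      using distributed_integrable_var[OF D] integrable_normal_moment_nz_1[OF pos] by simp
    have ic: "integrable M (\<lambda>\<omega>. (Z \<omega> - m)\<^sup>2)"
      using distributed_integrable[OF D, of "\<lambda>x. (x - m)\<^sup>2"] integrable_normal_moment[OF pos, of m 2]
      by simp
    have V: "expectation (\<lambda>\<omega>. (Z \<omega> - m)\<^sup>2) = v"
      using normal_distributed_variance[OF pos D] E \<open>0 \<le> v\<close> by simp
    have eq: "(Z \<omega>)\<^sup>2 = (Z \<omega> - m)\<^sup>2 + (2 * m * Z \<omega> - m\<^sup>2)" for \<omega>
      by (simp add: power2_eq_square algebra_simps)
    have i2: "integrable M (\<lambda>\<omega>. (Z \<omega>)\<^sup>2)"
      unfolding eq using ic iZ by (intro Bochner_Integration.integrable_add) auto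
    have "expectation (\<lambda>\<omega>. (Z \<omega>)\<^sup>2) = v + (2 * m * m - m\<^sup>2)"
      unfolding eq using ic iZ
      by (subst Bochner_Integration.integral_add) (auto simp: V E prob_space)
    then show ?thesis
      using E iZ i2 by (simp add: power2_eq_square)
  qed
  then show "integrable M Z" and "integrable M (\<lambda>\<omega>. (Z \<omega>)\<^sup>2)"
    and "expectation Z = m" and "expectation (\<lambda>\<omega>. (Z \<omega>)\<^sup>2) = v + m\<^sup>2"
    by blast+
qed

lemma integral_std_normal_cos:
  "(\<integral>x. std_normal_density x * cos (t * x) \<partial>lborel) = exp (- t\<^sup>2 / 2)"
proof -
  interpret real_distribution std_normal_distribution
    by (rule real_dist_normal_dist)
  have "exp (- t\<^sup>2 / 2) = Re (char std_normal_distribution t)"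
    unfolding char_std_normal_distribution by simp
  also have "\<dots> = (\<integral>x. Re (iexp (t * x)) \<partial>std_normal_distribution)"
    unfolding char_def by (intro integral_Re[symmetric] integrable_iexp) auto
  also have "\<dots> = (\<integral>x. cos (t * x) \<partial>std_normal_distribution)"
    by (intro Bochner_Integration.integral_cong) (auto simp: Re_exp)
  also have "\<dots> = (\<integral>x. std_normal_density x * cos (t * x) \<partial>lborel)"
    by (subst integral_density) (auto simp: normal_density_nonneg)
  finally show ?thesis
    by simp
qed

text \<open>The real part of the characteristic function at \<open>1\<close>. The Gaussian law enters the proof of
  unboundedness only through this formula and the first two moments.\<close>

lemma (in prob_space) normal_rv_expectation_cos:
  assumes "normal_rv M Z 0 v"
  shows "expectation (\<lambda>\<omega>. cos (Z \<omega>)) = exp (- v / 2)"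
proof (cases "v = 0")
  case True
  then have "AE \<omega> in M. Z \<omega> = 0"
    using assms by (simp add: normal_rv_def)
  then have AE: "AE \<omega> in M. cos (Z \<omega>) = 1"
    by eventually_elim simp
  have [measurable]: "Z \<in> borel_measurable M"
    using assms by (simp add: normal_rv_def)
  show ?thesis
    by (subst integral_cong_AE[OF _ _ AE]) (auto simp: prob_space True)
next
  case False
  then have v: "0 < v" and D: "distributed M lborel Z (normal_density 0 (sqrt v))"
    using assms by (auto simp: normal_rv_def)
  have "distributed M lborel (\<lambda>\<omega>. (Z \<omega> - 0) / sqrt v) std_normal_density"
    using normal_standard_normal_convert[of "sqrt v" Z 0] v D by simp
  from distributed_integral[OF this, of "\<lambda>x. cos (sqrt v * x)"]
  have "(\<integral>x. std_normal_density x * cos (sqrt v * x) \<partial>lborel) = expectation (\<lambda>\<omega>. cos (Z \<omega>))"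
    using v by simp
  then show ?thesis
    using v by (simp add: integral_std_normal_cos)
qed

section \<open>Nearly uncorrelated normal variables\<close>

lemma cosh_minus_one_le:
  fixes r :: real
  assumes "0 \<le> r" "r \<le> 1"
  shows "(exp r + exp (- r)) / 2 - 1 \<le> r"
proof -
  have "exp r \<le> 1 + r + r\<^sup>2"
    using assms by (intro exp_bound)
  moreover have "exp (- r) \<le> 1"
    using assms by simp
  moreover have "r\<^sup>2 \<le> r"
    using assms by (simp add: power2_eq_square mult_left_le)
  ultimately show ?thesis
    using assms by argo
qed

text \<open>The diagonal of the double sum contributes at most \<open>n\<close>, and so does the rest, which
  consists of at most \<open>n\<^sup>2\<close> terms of size at most \<open>1 / n\<close>.\<close>

lemma (in prob_space) second_moment_sum_le:
  fixes Z :: "nat \<Rightarrow> 'a \<Rightarrow> real"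
  assumes int: "\<And>j k. j < n \<Longrightarrow> k < n \<Longrightarrow> integrable M (\<lambda>\<omega>. Z j \<omega> * Z k \<omega>)"
    and cov: "\<And>j k. j < n \<Longrightarrow> k < n \<Longrightarrow>
      expectation (\<lambda>\<omega>. Z j \<omega> * Z k \<omega>) \<le> (if j = k then 1 else 1 / n)"
  shows "integrable M (\<lambda>\<omega>. (\<Sum>k<n. Z k \<omega>)\<^sup>2)"
    and "expectation (\<lambda>\<omega>. (\<Sum>k<n. Z k \<omega>)\<^sup>2) \<le> 2 * real n"
proof -
  have eq: "(\<Sum>k<n. Z k \<omega>)\<^sup>2 = (\<Sum>j<n. \<Sum>k<n. Z j \<omega> * Z k \<omega>)" for \<omega>
    by (simp add: power2_eq_square sum_product)
  show "integrable M (\<lambda>\<omega>. (\<Sum>k<n. Z k \<omega>)\<^sup>2)"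
    unfolding eq using int by (intro Bochner_Integration.integrable_sum) auto
  have "expectation (\<lambda>\<omega>. (\<Sum>k<n. Z k \<omega>)\<^sup>2)
      = (\<Sum>j<n. \<Sum>k<n. expectation (\<lambda>\<omega>. Z j \<omega> * Z k \<omega>))"
    unfolding eq using int
    by (subst Bochner_Integration.integral_sum; (intro Bochner_Integration.integrable_sum sum.cong)?)
      auto
  also have "\<dots> \<le> (\<Sum>j<n. \<Sum>k<n. (if j = k then 1 else 0) + 1 / n)"
    by (intro sum_mono order_trans[OF cov]) auto
  also have "\<dots> = 2 * real n"
    by (simp add: sum.distrib)
  finally show "expectation (\<lambda>\<omega>. (\<Sum>k<n. Z k \<omega>)\<^sup>2) \<le> 2 * real n" .
qed

text \<open>The laws of \<open>U + V\<close> and \<open>U - V\<close> stand for a joint Gaussian law with correlation \<open>r\<close>: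
  by \<open>4 U V = (U + V)\<^sup>2 - (U - V)\<^sup>2\<close> and \<open>2 cos U cos V = cos (U + V) + cos (U - V)\<close> they determine
  both expectations. The covariance of the cosines is \<open>(cosh r - 1) / e\<close>, so a small correlation of
  \<open>U\<close> and \<open>V\<close> makes the bounded variables \<open>cos U\<close> and \<open>cos V\<close> nearly uncorrelated too.\<close>

lemma (in prob_space) standard_normal_pair:
  assumes U: "normal_rv M U 0 1" and V: "normal_rv M V 0 1"
    and plus: "normal_rv M (\<lambda>\<omega>. U \<omega> + V \<omega>) 0 (2 + 2 * r)"
    and minus: "normal_rv M (\<lambda>\<omega>. U \<omega> - V \<omega>) 0 (2 - 2 * r)"
    and r: "0 \<le> r"
  shows "integrable M (\<lambda>\<omega>. U \<omega> * V \<omega>)" and "expectation (\<lambda>\<omega>. U \<omega> * V \<omega>) = r"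
    and "expectation (\<lambda>\<omega>. (cos (U \<omega>) - exp (- 1 / 2)) * (cos (V \<omega>) - exp (- 1 / 2))) \<le> r"
proof -
  define a :: real where "a = exp (- 1 / 2)"
  have [measurable]: "U \<in> borel_measurable M" "V \<in> borel_measurable M"
    using U V by (auto simp: normal_rv_def)
  have r1: "r \<le> 1"
    using minus by (auto simp: normal_rv_def)
  note P = normal_rv_moments[OF plus] and Q = normal_rv_moments[OF minus]
  have eq: "U \<omega> * V \<omega> = ((U \<omega> + V \<omega>)\<^sup>2 - (U \<omega> - V \<omega>)\<^sup>2) / 4" for \<omega>
    by (simp add: power2_eq_square algebra_simps)
  show "integrable M (\<lambda>\<omega>. U \<omega> * V \<omega>)"
    unfolding eq using P Q by auto
  show "expectation (\<lambda>\<omega>. U \<omega> * V \<omega>) = r"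
    unfolding eq using P Q by simp
  have int: "integrable M (\<lambda>\<omega>. cos (f \<omega>))" if "f \<in> borel_measurable M" for f :: "'a \<Rightarrow> real"
    using that by (intro integrable_const_bound[where B = 1]) auto
  have eq': "(cos (U \<omega>) - a) * (cos (V \<omega>) - a) =
      cos (U \<omega> + V \<omega>) / 2 + cos (U \<omega> - V \<omega>) / 2 - a * cos (U \<omega>) - a * cos (V \<omega>) + a\<^sup>2" for \<omega>
    unfolding cos_add cos_diff by (simp add: power2_eq_square field_simps)
  have cU: "expectation (\<lambda>\<omega>. cos (U \<omega>)) = a" and cV: "expectation (\<lambda>\<omega>. cos (V \<omega>)) = a"
    unfolding a_def using normal_rv_expectation_cos[OF U] normal_rv_expectation_cos[OF V] by simp_all
  have a2: "a\<^sup>2 = exp (- 1)"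
    unfolding a_def using exp_double[of "- 1 / 2 :: real"] by simp
  have "expectation (\<lambda>\<omega>. cos (U \<omega> + V \<omega>)) = exp (- 1 + - r)"
    unfolding normal_rv_expectation_cos[OF plus] by (simp add: field_simps)
  then have cP: "expectation (\<lambda>\<omega>. cos (U \<omega> + V \<omega>)) = a\<^sup>2 * exp (- r)"
    unfolding a2 exp_add .
  have "expectation (\<lambda>\<omega>. cos (U \<omega> - V \<omega>)) = exp (- 1 + r)"
    unfolding normal_rv_expectation_cos[OF minus] by (simp add: field_simps)
  then have cM: "expectation (\<lambda>\<omega>. cos (U \<omega> - V \<omega>)) = a\<^sup>2 * exp r"
    unfolding a2 exp_add .
  have "expectation (\<lambda>\<omega>. (cos (U \<omega>) - a) * (cos (V \<omega>) - a))
      = a\<^sup>2 * exp (- r) / 2 + a\<^sup>2 * exp r / 2 - a * a - a * a + a\<^sup>2"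
    unfolding eq' using int by (simp add: cU cV cP cM prob_space)
  also have "a\<^sup>2 * exp (- r) / 2 + a\<^sup>2 * exp r / 2 - a * a - a * a + a\<^sup>2
      = a\<^sup>2 * ((exp r + exp (- r)) / 2 - 1)"
    by (simp add: field_simps power2_eq_square)
  also have "\<dots> \<le> a\<^sup>2 * r"
    using r r1 by (intro mult_left_mono cosh_minus_one_le) auto
  also have "\<dots> \<le> r"
    using r by (intro mult_left_le_one_le) (auto simp: a_def power_le_one)
  finally show "expectation (\<lambda>\<omega>. (cos (U \<omega>) - exp (- 1 / 2)) * (cos (V \<omega>) - exp (- 1 / 2))) \<le> r"
    unfolding a_def .
qed

lemma one_minus_cos_le_abs: "1 - cos x \<le> \<bar>x\<bar>" for x :: real
proof -
  have "1 - cos x = 2 * (sin (x / 2))\<^sup>2"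
    using cos_double_sin[of "x / 2"] by simp
  also have "\<dots> = 2 * (\<bar>sin (x / 2)\<bar> * \<bar>sin (x / 2)\<bar>)"
    by (simp add: power2_eq_square)
  also have "\<dots> \<le> 2 * (\<bar>sin (x / 2)\<bar> * 1)"
    by (intro mult_left_mono) auto
  also have "\<dots> \<le> \<bar>x\<bar>"
    using abs_sin_x_le_abs_x[of "x / 2"] by simp
  finally show ?thesis .
qed

text \<open>The function \<open>g x = x + (1 - cos x)\<close> satisfies \<open>g x \<le> 2 max x 0\<close>, because \<open>1 - cos x \<le> \<bar>x\<bar>\<close>, while \<open>g (U k)\<close> has
  the positive mean \<open>m\<close>. If every \<open>U k\<close> is at most \<open>m / 4\<close>, then the average of the \<open>g (U k)\<close> is at most
  \<open>m / 2\<close>, hence below its mean by at least \<open>m / 2\<close>; Chebyshev's inequality bounds the probability of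
  such a deviation. The covariances of the two parts of \<open>g\<close> are explicit, unlike
  those of the indicator of a half-line.\<close>

lemma (in prob_space) prob_all_normal_le_small:
  fixes U :: "nat \<Rightarrow> 'a \<Rightarrow> real" and r :: "nat \<Rightarrow> nat \<Rightarrow> real" and n :: nat and m :: real
  defines "m \<equiv> 1 - exp (- 1 / 2)"
  assumes n: "0 < n"
    and U: "\<And>k. k < n \<Longrightarrow> normal_rv M (U k) 0 1"
    and plus: "\<And>j k. j < n \<Longrightarrow> k < n \<Longrightarrow> normal_rv M (\<lambda>\<omega>. U j \<omega> + U k \<omega>) 0 (2 + 2 * r j k)"
    and minus: "\<And>j k. j < n \<Longrightarrow> k < n \<Longrightarrow> normal_rv M (\<lambda>\<omega>. U j \<omega> - U k \<omega>) 0 (2 - 2 * r j k)"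
    and r0: "\<And>j k. j < n \<Longrightarrow> k < n \<Longrightarrow> 0 \<le> r j k"
    and rn: "\<And>j k. j < n \<Longrightarrow> k < n \<Longrightarrow> j \<noteq> k \<Longrightarrow> r j k \<le> 1 / n"
  shows "prob {\<omega>\<in>space M. \<forall>k<n. U k \<omega> \<le> m / 4} \<le> 32 / (m\<^sup>2 * n)"
proof -
  have m: "0 < m"
    by (simp add: m_def)
  have meas[measurable]: "U k \<in> borel_measurable M" if "k < n" for k
    using U[OF that] by (simp add: normal_rv_def)
  note pair = standard_normal_pair[OF U U plus minus r0]
  have r1: "r j k \<le> 1" if "j < n" "k < n" for j k
    using minus[OF that] by (simp add: normal_rv_def)
  define C where "C k \<omega> = cos (U k \<omega>) - exp (- 1 / 2)" for k \<omega>
  define S where "S \<omega> = (\<Sum>k<n. U k \<omega>)" for \<omega>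
  define T where "T \<omega> = (\<Sum>k<n. C k \<omega>)" for \<omega>
  have Cmeas[measurable]: "C k \<in> borel_measurable M" if "k < n" for k
    unfolding C_def using meas[OF that] by measurable
  \<comment> \<open>\<open>S - T\<close> is the centred sum of the \<open>g (U k)\<close>; its linear and cosine parts are bounded
    separately, which avoids their mixed moments.\<close>
  have S: "integrable M (\<lambda>\<omega>. (S \<omega>)\<^sup>2)" "expectation (\<lambda>\<omega>. (S \<omega>)\<^sup>2) \<le> 2 * real n"
    unfolding S_def using pair(1,2) rn r1
    by (auto intro!: second_moment_sum_le)
  have iC: "integrable M (\<lambda>\<omega>. C j \<omega> * C k \<omega>)" if "j < n" "k < n" for j k
  proof (rule integrable_const_bound[where B = 4])
    have "\<bar>C k \<omega>\<bar> \<le> 2" for k \<omega>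
    proof -
      have "exp (- 1 / 2 :: real) \<le> 1"
        by simp
      moreover have "0 < exp (- 1 / 2 :: real)"
        by (rule exp_gt_zero)
      moreover have "\<bar>cos (U k \<omega>)\<bar> \<le> 1"
        by simp
      ultimately show ?thesis
        unfolding C_def by argo
    qed
    then have "\<bar>C j \<omega>\<bar> * \<bar>C k \<omega>\<bar> \<le> 2 * 2" for \<omega>
      by (intro mult_mono) auto
    then show "AE \<omega> in M. norm (C j \<omega> * C k \<omega>) \<le> 4"
      by (simp add: abs_mult)
  qed (use that in measurable)
  have T: "integrable M (\<lambda>\<omega>. (T \<omega>)\<^sup>2)" "expectation (\<lambda>\<omega>. (T \<omega>)\<^sup>2) \<le> 2 * real n"
  proof -
    have "expectation (\<lambda>\<omega>. C j \<omega> * C k \<omega>) \<le> (if j = k then 1 else 1 / n)"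
      if "j < n" "k < n" for j k
      using pair(3)[OF that(1,2,1,2,1,2,1,2)] rn[OF that] r1[OF that] unfolding C_def by auto
    with iC show "integrable M (\<lambda>\<omega>. (T \<omega>)\<^sup>2)" "expectation (\<lambda>\<omega>. (T \<omega>)\<^sup>2) \<le> 2 * real n"
      unfolding T_def by (auto intro!: second_moment_sum_le)
  qed
  define A where "A = {\<omega>\<in>space M. \<forall>k<n. U k \<omega> \<le> m / 4}"
  have A[measurable]: "A \<in> sets M"
    unfolding A_def by measurable
  have bound: "(n * m / 2)\<^sup>2 * indicator A \<omega> \<le> 2 * (S \<omega>)\<^sup>2 + 2 * (T \<omega>)\<^sup>2" for \<omega>
  proof (cases "\<omega> \<in> A")
    case True
    have "S \<omega> - T \<omega> = (\<Sum>k<n. U k \<omega> + (1 - cos (U k \<omega>)) - m)"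
      by (simp add: S_def T_def C_def m_def sum_subtractf[symmetric] algebra_simps)
    also have "\<dots> \<le> (\<Sum>k<n. - (m / 2))"
    proof (rule sum_mono)
      fix k assume "k \<in> {..<n}"
      then have "U k \<omega> \<le> m / 4"
        using True by (simp add: A_def)
      then show "U k \<omega> + (1 - cos (U k \<omega>)) - m \<le> - (m / 2)"
        using one_minus_cos_le_abs[of "U k \<omega>"] m by linarith
    qed
    finally have "n * m / 2 \<le> - (S \<omega> - T \<omega>)"
      by simp
    then have "(n * m / 2)\<^sup>2 \<le> (- (S \<omega> - T \<omega>))\<^sup>2"
      using m by (intro power_mono) auto
    also have "\<dots> \<le> 2 * (S \<omega>)\<^sup>2 + 2 * (T \<omega>)\<^sup>2"
      using zero_le_power2[of "S \<omega> + T \<omega>"] by (simp add: power2_eq_square algebra_simps)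
    finally show ?thesis
      using True by simp
  qed simp
  have "(n * m / 2)\<^sup>2 * prob A = expectation (\<lambda>\<omega>. (n * m / 2)\<^sup>2 * indicator A \<omega>)"
    by simp
  also have "\<dots> \<le> expectation (\<lambda>\<omega>. 2 * (S \<omega>)\<^sup>2 + 2 * (T \<omega>)\<^sup>2)"
    using S(1) T(1) by (intro integral_mono bound) (auto intro!: integrable_mult_right simp: emeasure_eq_measure)
  also have "\<dots> \<le> 8 * real n"
    using S T by simp
  finally have "(n * m / 2)\<^sup>2 * prob A \<le> 8 * real n" .
  then show ?thesis
    using m n unfolding A_def[symmetric] by (simp add: field_simps power2_eq_square)
qed

section \<open>Fractional Brownian motion is unbounded above\<close>

lemma (in prob_space) fbm_linear_combination:
  assumes fbm: "fractional_brownian_motion M H c Y" and s: "0 \<le> s" and t: "0 \<le> t"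
  shows "normal_rv M (\<lambda>\<omega>. a * Y s \<omega> + b * Y t \<omega>) 0
    (c\<^sup>2 * (a\<^sup>2 * s powr (2 * H) + b\<^sup>2 * t powr (2 * H)
      + a * b * (s powr (2 * H) + t powr (2 * H) - \<bar>t - s\<bar> powr (2 * H))))"
    (is "normal_rv M ?Z 0 ?v")
proof -
  have gauss: "\<exists>m v. normal_rv M (\<lambda>\<omega>. \<Sum>i\<in>J. f i * Y i \<omega>) m v"
    if "finite J" "J \<subseteq> {0..}" for J f
    using fbm that by (auto simp: fractional_brownian_motion_def gaussian_process_def)
  have mean: "expectation (Y u) = 0" if "0 \<le> u" for u
    using fbm that by (simp add: fractional_brownian_motion_def)
  have cov: "expectation (\<lambda>\<omega>. Y u \<omega> * Y w \<omega>) =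
      c\<^sup>2 / 2 * (u powr (2 * H) + w powr (2 * H) - \<bar>w - u\<bar> powr (2 * H))" if "0 \<le> u" "0 \<le> w" for u w
    using fbm that by (simp add: fractional_brownian_motion_def)
  have var: "expectation (\<lambda>\<omega>. (Y u \<omega>)\<^sup>2) = c\<^sup>2 * u powr (2 * H)" if "0 \<le> u" for u
    using cov[OF that that] by (simp add: power2_eq_square)
  have nY: "\<exists>m v. normal_rv M (Y u) m v" if "0 \<le> u" for u
    using gauss[of "{u}" "\<lambda>_. 1"] that by simp
  have iY: "integrable M (Y u)" and iY2: "integrable M (\<lambda>\<omega>. (Y u \<omega>)\<^sup>2)" if "0 \<le> u" for u
    using nY[OF that] normal_rv_moments(1,2) by blast+
  note [measurable] = borel_measurable_integrable[OF iY[OF s]] borel_measurable_integrable[OF iY[OF t]]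
  have iYY: "integrable M (\<lambda>\<omega>. Y s \<omega> * Y t \<omega>)"
  proof (rule Bochner_Integration.integrable_bound)
    show "integrable M (\<lambda>\<omega>. (Y s \<omega>)\<^sup>2 + (Y t \<omega>)\<^sup>2)"
      using iY2 s t by auto
    have "\<bar>x * y\<bar> \<le> x\<^sup>2 + y\<^sup>2" for x y :: real
      using sum_squares_bound[of "\<bar>x\<bar>" "\<bar>y\<bar>"] mult_nonneg_nonneg[OF abs_ge_zero abs_ge_zero, of x y]
      unfolding abs_mult power2_abs by linarith
    then show "AE \<omega> in M. norm (Y s \<omega> * Y t \<omega>) \<le> norm ((Y s \<omega>)\<^sup>2 + (Y t \<omega>)\<^sup>2)"
      by simp
  qed measurable
  have "\<exists>m v. normal_rv M ?Z m v"
  proof (cases "s = t")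
    case True
    then show ?thesis
      using gauss[of "{s}" "\<lambda>_. a + b"] s by (simp add: distrib_right)
  next
    case False
    then show ?thesis
      using gauss[of "{s, t}" "\<lambda>i. if i = s then a else b"] s t by simp
  qed
  then obtain m v where Z: "normal_rv M ?Z m v"
    by blast
  have "m = expectation ?Z"
    using normal_rv_moments(3)[OF Z] by simp
  also have "\<dots> = 0"
    using iY s t mean by simp
  finally have m: "m = 0" .
  have "v = expectation (\<lambda>\<omega>. (?Z \<omega>)\<^sup>2)"
    using normal_rv_moments(4)[OF Z] m by simp
  also have "\<dots> = expectation (\<lambda>\<omega>. a\<^sup>2 * (Y s \<omega>)\<^sup>2 + b\<^sup>2 * (Y t \<omega>)\<^sup>2 + 2 * a * b * (Y s \<omega> * Y t \<omega>))"
    by (intro Bochner_Integration.integral_cong) (auto simp: power2_eq_square algebra_simps)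
  also have "\<dots> = a\<^sup>2 * expectation (\<lambda>\<omega>. (Y s \<omega>)\<^sup>2) + b\<^sup>2 * expectation (\<lambda>\<omega>. (Y t \<omega>)\<^sup>2)
      + 2 * a * b * expectation (\<lambda>\<omega>. Y s \<omega> * Y t \<omega>)"
    using iY2 iYY s t by simp
  also have "\<dots> = ?v"
    unfolding var[OF s] var[OF t] cov[OF s t] by (simp add: field_simps)
  finally show ?thesis
    using Z m by simp
qed

definition fbm_correlation :: "real \<Rightarrow> real \<Rightarrow> real \<Rightarrow> real" where
  "fbm_correlation H s t =
     (s powr (2 * H) + t powr (2 * H) - \<bar>t - s\<bar> powr (2 * H)) / (2 * s powr H * t powr H)"

lemma fbm_correlation_commute: "fbm_correlation H s t = fbm_correlation H t s"
  by (simp add: fbm_correlation_def abs_minus_commute ac_simps)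

lemma fbm_correlation_nonneg:
  assumes "0 < H" "0 < s" "0 < t"
  shows "0 \<le> fbm_correlation H s t"
proof -
  have "\<bar>t - s\<bar> powr (2 * H) \<le> (max s t) powr (2 * H)"
    using assms by (intro powr_mono2) auto
  also have "\<dots> \<le> s powr (2 * H) + t powr (2 * H)"
    by (simp add: max_def)
  finally show ?thesis
    by (simp add: fbm_correlation_def)
qed

text \<open>The ratio \<open>r = s / t\<close> is at most \<open>x\<close>, and \<open>(1 - r) powr (2 * H) \<ge> (1 - r)\<^sup>2 \<ge> 1 - 2 * r\<close> bounds
  the numerator, after division by \<open>t powr (2 * H)\<close>, by \<open>r powr (2 * H) + 2 * r\<close>. As \<open>0 < H < 1\<close>,
  both powers of \<open>x\<close> in the bound vanish as \<open>x\<close> tends to \<open>0\<close>: values at times of very different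
  order are nearly uncorrelated.\<close>

lemma fbm_correlation_le:
  assumes H: "0 < H" "H < 1" and "0 < s" "0 < t" and x: "0 < x" "x \<le> 1" and st: "s \<le> x * t"
  shows "fbm_correlation H s t \<le> x powr H + x powr (1 - H)"
proof -
  define r where "r = s / t"
  have r: "0 < r" "r \<le> x" and s: "s = r * t"
    using assms by (auto simp: r_def field_simps)
  have sH: "s powr h = r powr h * t powr h" for h
    unfolding s by (rule powr_mult)
  have "\<bar>t - s\<bar> = (1 - r) * t"
    using r x \<open>0 < t\<close> unfolding s by (simp add: algebra_simps mult_left_le_one_le)
  then have diff: "\<bar>t - s\<bar> powr (2 * H) = (1 - r) powr (2 * H) * t powr (2 * H)"
    using r x \<open>0 < t\<close> by (simp add: powr_mult)
  have "1 - 2 * r \<le> (1 - r)\<^sup>2"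
    by (simp add: power2_eq_square algebra_simps)
  also have "(1 - r)\<^sup>2 = (1 - r) powr 2"
    using r x by simp
  also have "\<dots> \<le> (1 - r) powr (2 * H)"
    using r x H by (intro powr_mono') auto
  finally have core: "r powr (2 * H) + 1 - (1 - r) powr (2 * H) \<le> r powr (2 * H) + 2 * r"
    by simp
  have t2: "t powr (2 * H) = t powr H * t powr H" and r2: "r powr (2 * H) = r powr H * r powr H"
    and r1: "r = r powr H * r powr (1 - H)"
    using r by (auto simp: powr_add[symmetric])
  have "fbm_correlation H s t = (r powr (2 * H) + 1 - (1 - r) powr (2 * H)) / (2 * r powr H)"
    unfolding fbm_correlation_def diff sH t2 using \<open>0 < t\<close> r by (simp add: field_simps)
  also have "\<dots> \<le> (r powr (2 * H) + 2 * r) / (2 * r powr H)"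
    by (intro divide_right_mono core) simp
  also have "\<dots> = r powr H / 2 + r powr (1 - H)"
    unfolding r2 using r by (subst (3) r1) (simp add: field_simps)
  also have "\<dots> \<le> r powr H + r powr (1 - H)"
    by simp
  also have "\<dots> \<le> x powr H + x powr (1 - H)"
    using r H by (intro add_mono powr_mono2) auto
  finally show ?thesis .
qed

text \<open>Sampling at the times \<open>R, R\<^sup>2, \<dots>, R\<^sup>n\<close> and dividing by the standard deviations yields \<open>n\<close> standard
  normal variables. For large \<open>R\<close> their correlations are below \<open>1 / n\<close>, and a bound \<open>K\<close> on the path
  makes each of them at most \<open>\<bar>K\<bar> / (c * R powr H)\<close>, which is arbitrarily small. The probability of
  this is \<open>O(1 / n)\<close>, for every \<open>n\<close>. Integer times suffice, which makes the event measurable.\<close>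

lemma (in prob_space) fbm_unbounded_above:
  assumes fbm: "fractional_brownian_motion M H c Y"
  shows "AE \<omega> in M. \<exists>i::nat. K < Y (real i) \<omega>"
proof -
  have H: "0 < H" "H < 1" and c: "0 < c"
    using fbm by (auto simp: fractional_brownian_motion_def)
  have [measurable]: "Y (real i) \<in> borel_measurable M" for i :: nat
    using fbm_linear_combination[OF fbm, of "real i" "real i" 1 0] by (simp add: normal_rv_def)
  define bad where "bad = {\<omega>\<in>space M. \<forall>i::nat. Y (real i) \<omega> \<le> K}"
  have [measurable]: "bad \<in> sets M"
    unfolding bad_def by measurable
  define m :: real where "m = 1 - exp (- 1 / 2)"
  have m: "0 < m"
    by (simp add: m_def)
  have bad_le: "prob bad \<le> 32 / (m\<^sup>2 * n)" if n: "0 < n" for n :: nat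
  proof -
    have "((\<lambda>R. \<bar>K\<bar> / c * real R powr (- H)) \<longlongrightarrow> \<bar>K\<bar> / c * 0) sequentially"
      using H by (intro tendsto_intros tendsto_neg_powr filterlim_real_sequentially) auto
    then have "eventually (\<lambda>R. \<bar>K\<bar> / c * real R powr (- H) < m / 4) sequentially"
      using m by (intro order_tendstoD) auto
    moreover have "((\<lambda>R. real R powr (- H) + real R powr (- (1 - H))) \<longlongrightarrow> 0 + 0) sequentially"
      using H by (intro tendsto_intros tendsto_neg_powr filterlim_real_sequentially) auto
    then have "eventually (\<lambda>R. real R powr (- H) + real R powr (- (1 - H)) < 1 / n) sequentially"
      using n by (intro order_tendstoD) auto
    moreover note eventually_gt_at_top[of 1]
    ultimately have "eventually (\<lambda>R. \<bar>K\<bar> / c * real R powr (- H) < m / 4 \<and>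
        real R powr (- H) + real R powr (- (1 - H)) < 1 / n \<and> 1 < R) sequentially"
      by eventually_elim auto
    then obtain R :: nat where R: "\<bar>K\<bar> / c * real R powr (- H) < m / 4"
        "real R powr (- H) + real R powr (- (1 - H)) < 1 / n" "1 < R"
      by (auto dest!: eventually_happens)
    define t where "t k = real (R ^ Suc k)" for k
    have t: "0 < t k" "real R \<le> t k" for k
      using R(3) by (auto simp: t_def simp del: of_nat_power power_Suc intro!: self_le_power)
    \<comment> \<open>The standardized samples: \<open>c * t k powr H\<close> is the standard deviation of \<open>Y (t k)\<close>.\<close>
    define U where "U k \<omega> = 1 / (c * t k powr H) * Y (t k) \<omega>" for k \<omega>
    have pair: "normal_rv M (\<lambda>\<omega>. p * U j \<omega> + q * U k \<omega>) 0
        (p\<^sup>2 + q\<^sup>2 + 2 * p * q * fbm_correlation H (t j) (t k))" for p q j k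
    proof -
      have sq: "x powr (2 * H) = x powr H * x powr H" for x
        by (simp add: powr_add[symmetric])
      define A B D where "A = t j powr H" and "B = t k powr H" and "D = \<bar>t k - t j\<bar> powr (2 * H)"
      have AB: "0 < A" "0 < B"
        using t(1)[of j] t(1)[of k] by (auto simp: A_def B_def)
      have "c\<^sup>2 * ((p / (c * A))\<^sup>2 * (A * A) + (q / (c * B))\<^sup>2 * (B * B)
            + p / (c * A) * (q / (c * B)) * (A * A + B * B - D))
          = p\<^sup>2 + q\<^sup>2 + 2 * p * q * ((A * A + B * B - D) / (2 * A * B))"
        using AB c by (simp add: field_simps power2_eq_square)
      moreover have "normal_rv M (\<lambda>\<omega>. p / (c * A) * Y (t j) \<omega> + q / (c * B) * Y (t k) \<omega>) 0
          (c\<^sup>2 * ((p / (c * A))\<^sup>2 * (A * A) + (q / (c * B))\<^sup>2 * (B * B)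
            + p / (c * A) * (q / (c * B)) * (A * A + B * B - D)))"
        using fbm_linear_combination[OF fbm, of "t j" "t k" "p / (c * A)" "q / (c * B)"] t
        by (simp add: A_def B_def D_def sq[of "t j"] sq[of "t k"] less_imp_le)
      ultimately show ?thesis
        by (simp add: U_def fbm_correlation_def A_def B_def D_def sq[of "t j"] sq[of "t k"])
    qed
    have corr_less: "fbm_correlation H (t j) (t k) \<le> 1 / n" if "j < k" for j k
    proof -
      have "real R * t j \<le> t k"
      proof -
        have "R ^ Suc (Suc j) \<le> R ^ Suc k"
          using R(3) that by (intro power_increasing) auto
        then have "real (R ^ Suc (Suc j)) \<le> real (R ^ Suc k)"
          by (simp only: of_nat_le_iff)
        then show ?thesis
          by (simp add: t_def)
      qed
      then have "t j \<le> 1 / R * t k"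
        using R(3) by (simp add: field_simps)
      then have "fbm_correlation H (t j) (t k) \<le> (1 / R) powr H + (1 / R) powr (1 - H)"
        using R(3) H t by (intro fbm_correlation_le) auto
      also have "\<dots> = real R powr (- H) + real R powr (- (1 - H))"
        using R(3) by (simp only: powr_minus_divide powr_divide) (simp add: powr_divide)
      also have "\<dots> \<le> 1 / n"
        using R(2) by simp
      finally show ?thesis .
    qed
    have "prob {\<omega>\<in>space M. \<forall>k<n. U k \<omega> \<le> m / 4} \<le> 32 / (m\<^sup>2 * n)"
      unfolding m_def
    proof (rule prob_all_normal_le_small[where r = "\<lambda>j k. fbm_correlation H (t j) (t k)"])
      show "normal_rv M (U k) 0 1" for k
        using pair[of 1 k 0 k] by simp
      show "normal_rv M (\<lambda>\<omega>. U j \<omega> + U k \<omega>) 0 (2 + 2 * fbm_correlation H (t j) (t k))" for j k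
        using pair[of 1 j 1 k] by simp
      show "normal_rv M (\<lambda>\<omega>. U j \<omega> - U k \<omega>) 0 (2 - 2 * fbm_correlation H (t j) (t k))" for j k
        using pair[of 1 j "- 1" k] by simp
      show "0 \<le> fbm_correlation H (t j) (t k)" for j k
        using H t by (intro fbm_correlation_nonneg) auto
      show "fbm_correlation H (t j) (t k) \<le> 1 / n" if "j \<noteq> k" for j k
        using that corr_less[of j k] corr_less[of k j] fbm_correlation_commute[of H "t j" "t k"]
        by (cases "j < k") auto
    qed (fact n)
    moreover have "bad \<subseteq> {\<omega>\<in>space M. \<forall>k<n. U k \<omega> \<le> m / 4}"
    proof safe
      fix \<omega> k assume \<omega>: "\<omega> \<in> bad"
      then show "\<omega> \<in> space M"
        by (simp add: bad_def)
      have "Y (t k) \<omega> \<le> K"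
        using \<omega> unfolding bad_def t_def by blast
      then have "Y (t k) \<omega> \<le> \<bar>K\<bar>"
        by simp
      then have "U k \<omega> \<le> 1 / (c * t k powr H) * \<bar>K\<bar>"
        unfolding U_def using c by (intro mult_left_mono) auto
      also have "\<dots> = \<bar>K\<bar> / c * t k powr (- H)"
        by (simp add: powr_minus_divide)
      also have "\<dots> \<le> \<bar>K\<bar> / c * real R powr (- H)"
        using c H t R(3) by (intro mult_left_mono powr_mono2') auto
      also have "\<dots> \<le> m / 4"
        using R(1) by (rule less_imp_le)
      finally show "U k \<omega> \<le> m / 4" .
    qed
    moreover have "{\<omega>\<in>space M. \<forall>k<n. U k \<omega> \<le> m / 4} \<in> sets M"
      unfolding U_def t_def by measurable
    ultimately show ?thesis
      using finite_measure_mono order_trans by blast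
  qed
  have "(\<lambda>n. 32 / (m\<^sup>2 * real n)) \<longlonglongrightarrow> 0"
    using m by (intro tendsto_divide_0[OF tendsto_const] filterlim_at_top_imp_at_infinity
        filterlim_tendsto_pos_mult_at_top[OF tendsto_const] filterlim_real_sequentially) auto
  then have "prob bad \<le> 0"
    by (rule LIMSEQ_le_const) (use bad_le in \<open>auto intro!: exI[of _ 1]\<close>)
  then have "prob bad = 0"
    using measure_nonneg[of M bad] by linarith
  then have "AE \<omega> in M. \<omega> \<notin> bad"
    by (simp add: AE_iff_measurable[OF _ refl] emeasure_eq_measure bad_def[symmetric]) 
      (simp add: prob_eq_0)
  then show ?thesis
    by (rule AE_mp) (auto intro!: AE_I2 simp: bad_def not_le)
qed

section \<open>Hitting times\<close>

lemma level_reached_below: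
  fixes f :: "real \<Rightarrow> real"
  assumes "continuous_on {0..} f" and "f 0 \<le> s" and "0 \<le> u" and "s \<le> f u"
  shows "\<exists>w\<ge>0. w \<le> u \<and> f w = s"
  using IVT'[of f 0 s u] assms continuous_on_subset[of "{0..}" f "{0..u}"] by auto

text \<open>This exhibits the event that the level is reached as a countable combination of events at fixed
  times. The bound \<open>n\<close> on the times comes first: on \<open>{0..n}\<close> the supremum is attained, so
  approaching the level within a bounded interval means reaching it.\<close>

lemma level_reached_iff_rational_approximation:
  fixes f :: "real \<Rightarrow> real"
  assumes cont: "continuous_on {0..} f" and "f 0 \<le> s"
  shows "(\<exists>u\<ge>0. f u = s) \<longleftrightarrow>
    (\<exists>n::nat. \<forall>k::nat. \<exists>q\<in>\<rat> \<inter> {0..real n}. s - 1 / real (Suc k) < f q)"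
proof
  assume "\<exists>u\<ge>0. f u = s"
  then obtain u where u: "0 \<le> u" "f u = s"
    by blast
  obtain n :: nat where n: "u + 1 \<le> n"
    using real_arch_simple by blast
  have "\<exists>q\<in>\<rat> \<inter> {0..real n}. s - 1 / real (Suc k) < f q" for k :: nat
  proof -
    obtain d where d: "0 < d" "\<And>x. 0 \<le> x \<Longrightarrow> dist x u < d \<Longrightarrow> dist (f x) (f u) < 1 / real (Suc k)"
      using cont u(1) unfolding continuous_on_iff by (metis atLeast_iff of_nat_0_less_iff zero_less_Suc zero_less_divide_1_iff)
    obtain q where q: "q \<in> \<rat>" "u < q" "q < u + min d 1"
      using Rats_dense_in_real[of u "u + min d 1"] d(1) by auto
    have "dist (f q) (f u) < 1 / real (Suc k)"
      using q u by (intro d(2)) (auto simp: dist_real_def)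
    then have "s - 1 / real (Suc k) < f q"
      using u(2) by (simp add: dist_real_def abs_less_iff)
    moreover have "q \<in> \<rat> \<inter> {0..real n}"
      using q u(1) n by auto
    ultimately show ?thesis
      by blast
  qed
  then show "\<exists>n::nat. \<forall>k::nat. \<exists>q\<in>\<rat> \<inter> {0..real n}. s - 1 / real (Suc k) < f q"
    by blast
next
  assume "\<exists>n::nat. \<forall>k::nat. \<exists>q\<in>\<rat> \<inter> {0..real n}. s - 1 / real (Suc k) < f q"
  then obtain n :: nat where n: "\<And>k::nat. \<exists>q\<in>\<rat> \<inter> {0..real n}. s - 1 / real (Suc k) < f q"
    by blast
  have "continuous_on {0..real n} f"
    using cont by (rule continuous_on_subset) auto
  then obtain u where u: "u \<in> {0..real n}" "\<And>x. x \<in> {0..real n} \<Longrightarrow> f x \<le> f u"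
    using continuous_attains_sup[of "{0..real n}" f] by auto
  have "s - 1 / real (Suc k) \<le> f u" for k :: nat
    using n[of k] u(2) by force
  moreover have "(\<lambda>k. s - 1 / real (Suc k)) \<longlonglongrightarrow> s - 0"
    by (intro tendsto_diff tendsto_const LIMSEQ_Suc[OF lim_1_over_n])
  ultimately have "s \<le> f u"
    by (intro LIMSEQ_le_const2[of "\<lambda>k. s - 1 / real (Suc k)" s]) auto
  then show "\<exists>u\<ge>0. f u = s"
    using level_reached_below[OF cont \<open>f 0 \<le> s\<close>, of u] u(1) by auto
qed

text \<open>The infimum is attained because the set of times spent at the level is closed.\<close>

lemma hitting_time_attained:
  assumes cont: "continuous_on {0..} (\<lambda>t. Y t \<omega>)" and ex: "\<exists>u\<ge>0. Y u \<omega> = s"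
  shows "hitting_time Y s \<omega> < \<infinity>" and "Y (real_of_ereal (hitting_time Y s \<omega>)) \<omega> = s"
proof -
  define T where "T = {t. 0 \<le> t \<and> Y t \<omega> = s}"
  have T: "T \<noteq> {}" "bdd_below T"
    using ex by (auto simp: T_def intro!: bdd_belowI[of _ 0])
  have "closed ({0..} \<inter> (\<lambda>t. Y t \<omega>) -` {s})"
    using cont by (rule continuous_closed_preimage) auto
  also have "{0..} \<inter> (\<lambda>t. Y t \<omega>) -` {s} = T"
    by (auto simp: T_def)
  finally have "Inf T \<in> T"
    using T by (intro closed_contains_Inf)
  moreover have "hitting_time Y s \<omega> = ereal (Inf T)"
    unfolding hitting_time_def T_def[symmetric] using \<open>Inf T \<in> T\<close> T
    by (intro antisym INF_lower INF_greatest) (auto intro: cInf_lower)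
  ultimately show "hitting_time Y s \<omega> < \<infinity>" and "Y (real_of_ereal (hitting_time Y s \<omega>)) \<omega> = s"
    by (auto simp: T_def)
qed

text \<open>At a finite hitting time \<open>Y\<close> sits exactly at the level \<open>s\<close>, so the time change cancels and
  leaves \<open>X s\<close>. Where the level is never reached, \<open>real_of_ereal \<infinity> = 0\<close> and \<open>Y 0 = 0\<close> give \<open>X 0\<close>.\<close>

lemma at_hitting_times_random_time:
  assumes cont: "continuous_on {0..} (\<lambda>t. Y t \<omega>)" and Y0: "Y 0 \<omega> = 0"
  shows "at_hitting_times (random_time_process X Y) Y s \<omega> =
    (if \<exists>u\<ge>0. Y u \<omega> = s then X s \<omega> else X 0 \<omega>)"
proof (cases "\<exists>u\<ge>0. Y u \<omega> = s")
  case True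
  then show ?thesis
    using hitting_time_attained(2)[of Y \<omega> s, OF cont True]
    by (auto simp: at_hitting_times_def random_time_process_def)
next
  case False
  then have empty: "{t. 0 \<le> t \<and> Y t \<omega> = s} = {}"
    by auto
  have "hitting_time Y s \<omega> = \<infinity>"
    unfolding hitting_time_def empty by (simp add: top_ereal_def)
  then show ?thesis
    using False Y0 by (auto simp: at_hitting_times_def random_time_process_def)
qed

text \<open>Equality with \<open>X s\<close> almost surely is not enough, as the measure need not be complete; the event
  that the level is reached has to be measurable itself.\<close>

lemma at_hitting_times_measurable:
  assumes [measurable]: "\<And>t. 0 \<le> t \<Longrightarrow> Y t \<in> borel_measurable M" "\<And>s. X s \<in> borel_measurable M"
    and cont: "\<And>\<omega>. \<omega> \<in> space M \<Longrightarrow> continuous_on {0..} (\<lambda>t. Y t \<omega>)"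
    and Y0: "\<And>\<omega>. \<omega> \<in> space M \<Longrightarrow> Y 0 \<omega> = 0" and s: "0 \<le> s"
  shows "at_hitting_times (random_time_process X Y) Y s \<in> borel_measurable M"
proof -
  have ctb: "countable (\<rat> \<inter> {0..real n} :: real set)" for n :: nat
    by (rule countable_subset[OF _ countable_rat]) auto
  have "{\<omega>\<in>space M. \<exists>u\<ge>0. Y u \<omega> = s} = {\<omega>\<in>space M. \<exists>n::nat. \<forall>k::nat.
      \<exists>q\<in>\<rat> \<inter> {0..real n}. s - 1 / real (Suc k) < Y q \<omega>}"
    using s by (intro Collect_cong conj_cong refl level_reached_iff_rational_approximation cont) (auto simp: Y0)
  also have "\<dots> \<in> sets M"
    using ctb by (intro sets.sets_Collect sets.sets_Collect_countable_Ex') auto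
  finally have [measurable]: "{\<omega>\<in>space M. \<exists>u\<ge>0. Y u \<omega> = s} \<in> sets M" .
  have "(\<lambda>\<omega>. if \<exists>u\<ge>0. Y u \<omega> = s then X s \<omega> else X 0 \<omega>) \<in> borel_measurable M"
    by (rule measurable_If) auto
  then show ?thesis
    by (subst measurable_cong[OF at_hitting_times_random_time[OF cont Y0]])
qed

section \<open>Brownian motion from a Gaussian random measure\<close>

lemma (in prob_space) indep_vars_AE_cong:
  assumes ind: "indep_vars N V I" and I: "finite I"
    and W: "\<And>i. i \<in> I \<Longrightarrow> W i \<in> measurable M (N i)"
    and eq: "\<And>i. i \<in> I \<Longrightarrow> AE \<omega> in M. W i \<omega> = V i \<omega>"
  shows "indep_vars N W I"
proof (cases "I = {}")
  case True
  then show ?thesis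
    by (simp add: indep_vars_def indep_sets_def)
next
  case False
  have V: "\<And>i. i \<in> I \<Longrightarrow> V i \<in> measurable M (N i)"
    using ind by (auto simp: indep_vars_def)
  have "AE \<omega> in M. \<forall>i\<in>I. W i \<omega> = V i \<omega>"
    using I eq by (simp add: AE_finite_all)
  then have AE: "AE \<omega> in M. (\<lambda>i\<in>I. W i \<omega>) = (\<lambda>i\<in>I. V i \<omega>)"
    by eventually_elim auto
  have "distr M (\<Pi>\<^sub>M i\<in>I. N i) (\<lambda>x. \<lambda>i\<in>I. W i x) = distr M (\<Pi>\<^sub>M i\<in>I. N i) (\<lambda>x. \<lambda>i\<in>I. V i x)"
    using AE V W by (intro distr_cong_AE measurable_restrict) auto
  also have "\<dots> = (\<Pi>\<^sub>M i\<in>I. distr M (N i) (V i))"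
    using indep_vars_iff_distr_eq_PiM'[OF False, of V N] V ind by simp
  also have "\<dots> = (\<Pi>\<^sub>M i\<in>I. distr M (N i) (W i))"
  proof (intro PiM_cong refl distr_cong_AE)
    show "AE \<omega> in M. V i \<omega> = W i \<omega>" if "i \<in> I" for i
      using eq[OF that] by eventually_elim simp
  qed (use V W in auto)
  finally show ?thesis
    using indep_vars_iff_distr_eq_PiM'[OF False, of W N] W by simp
qed

lemma (in prob_space) brownian_motion_indistinguishable:
  assumes B: "brownian_motion M B" and C: "\<And>t. 0 \<le> t \<Longrightarrow> C t \<in> borel_measurable M"
    and eq: "AE \<omega> in M. \<forall>t\<ge>0. C t \<omega> = B t \<omega>"
  shows "brownian_motion M C"
  unfolding brownian_motion_def
proof (intro conjI allI impI)
  have Bm: "B t \<in> borel_measurable M" if "0 \<le> t" for t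
    using B that by (simp add: brownian_motion_def)
  have eqt: "AE \<omega> in M. C t \<omega> = B t \<omega>" if "0 \<le> t" for t
    using eq by eventually_elim (use that in simp)
  have eqd: "AE \<omega> in M. C t \<omega> - C s \<omega> = B t \<omega> - B s \<omega>" if "0 \<le> s" "0 \<le> t" for s t
    using eqt[OF that(1)] eqt[OF that(2)] by eventually_elim simp
  show "C t \<in> borel_measurable M" if "0 \<le> t" for t
    using C that .
  have "AE \<omega> in M. B 0 \<omega> = 0"
    using B by (simp add: brownian_motion_def)
  with eqt[OF order_refl] show "AE \<omega> in M. C 0 \<omega> = 0"
    by eventually_elim simp
  show "indep_vars (\<lambda>_. borel) (\<lambda>i \<omega>. C (s (Suc i)) \<omega> - C (s i) \<omega>) {..<n}"
    if s: "0 \<le> s 0 \<and> (\<forall>i<n. s i < s (Suc i))" for n s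
  proof -
    have s0: "0 \<le> s i" if "i \<le> n" for i
      using that
    proof (induction i)
      case (Suc i)
      then show ?case
        using s by (metis Suc_leD Suc_le_lessD less_imp_le order_trans)
    qed (use s in simp)
    show ?thesis
    proof (rule indep_vars_AE_cong)
      show "indep_vars (\<lambda>_. borel) (\<lambda>i \<omega>. B (s (Suc i)) \<omega> - B (s i) \<omega>) {..<n}"
        using B s by (simp add: brownian_motion_def)
    qed (auto intro!: eqd s0 borel_measurable_diff C)
  qed
  show "normal_rv M (\<lambda>\<omega>. C t \<omega> - C s \<omega>) 0 (t - s)" if "0 \<le> s \<and> s < t" for s t
  proof (rule normal_rv_AE_cong)
    show "normal_rv M (\<lambda>\<omega>. B t \<omega> - B s \<omega>) 0 (t - s)"
      using B that by (simp add: brownian_motion_def)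
  qed (use that in \<open>auto intro!: eqd borel_measurable_diff C\<close>)
  have "AE \<omega> in M. continuous_on {0..} (\<lambda>t. B t \<omega>)"
    using B by (simp add: brownian_motion_def)
  with eq show "AE \<omega> in M. continuous_on {0..} (\<lambda>t. C t \<omega>)"
    by eventually_elim (auto cong: continuous_on_cong_simp)
qed

text \<open>Apply \<open>\<sigma>\<close>-additivity to \<open>A, B, {}, {}, \<dots>\<close>; the empty set gets the value \<open>0\<close> almost surely since
  its variance is \<open>0\<close>.\<close>

lemma gaussian_random_measure_union:
  assumes G: "gaussian_random_measure M M0"
    and A: "A \<in> finite_borel" and B: "B \<in> finite_borel" and disj: "A \<inter> B = {}"
  shows "AE \<omega> in M. M0 (A \<union> B) \<omega> = M0 A \<omega> + M0 B \<omega>"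
proof -
  define D where "D i = (if i = 0 then A else if i = 1 then B else {})" for i :: nat
  have E: "{} \<in> finite_borel"
    by (simp add: finite_borel_def)
  have U: "(\<Union>i. D i) = A \<union> B"
    by (auto simp: D_def split: if_splits)
  have "A \<union> B \<in> finite_borel"
    using A B emeasure_subadditive[of A lborel B]
    by (auto simp: finite_borel_def intro: le_less_trans)
  then have "(\<forall>i. D i \<in> finite_borel) \<and> disjoint_family D \<and> (\<Union>i. D i) \<in> finite_borel"
    unfolding U using A B E disj by (auto simp: D_def disjoint_family_on_def)
  then have "AE \<omega> in M. (\<lambda>i. M0 (D i) \<omega>) sums M0 (\<Union>i. D i) \<omega>"
    using G unfolding gaussian_random_measure_def by blast
  moreover have "AE \<omega> in M. M0 {} \<omega> = 0"
    using G E by (auto simp: gaussian_random_measure_def normal_rv_def)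
  ultimately show ?thesis
  proof eventually_elim
    case (elim \<omega>)
    have "(\<lambda>i. M0 (D i) \<omega>) sums (\<Sum>i\<in>{0, 1}. M0 (D i) \<omega>)"
      using elim(2) by (intro sums_finite) (auto simp: D_def)
    then have "(\<lambda>i. M0 (D i) \<omega>) sums (M0 A \<omega> + M0 B \<omega>)"
      by (simp add: D_def)
    with elim(1) show ?case
      unfolding U by (rule sums_unique2)
  qed
qed

text \<open>The increment of \<open>X\<close> over \<open>[s, t]\<close> is almost surely the random measure of \<open>{s<..t}\<close>, because
  \<open>{0..t}\<close> is the disjoint union of \<open>{0..s}\<close> and \<open>{s<..t}\<close>. Half-open intervals keep the intervals of
  consecutive increments disjoint.\<close>

lemma (in prob_space) continuous_version_brownian_motion:
  assumes G: "gaussian_random_measure M M0" and X: "continuous_version M M0 X"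
  shows "brownian_motion M X"
  unfolding brownian_motion_def
proof (intro conjI allI impI)
  have Xm: "X t \<in> borel_measurable M" for t
    using X by (simp add: continuous_version_def)
  then show "X t \<in> borel_measurable M" for t .
  have eq: "AE \<omega> in M. X t \<omega> = M0 {0..t} \<omega>" if "0 \<le> t" for t
    using X that by (auto simp: continuous_version_def closed_segment_eq_real_ivl dest!: spec[of _ t])
  have fin: "{a..b} \<in> finite_borel" "{a<..b} \<in> finite_borel" if "a \<le> b" for a b :: real
    using that by (auto simp: finite_borel_def)
  have N: "normal_rv M (M0 A) 0 (measure lborel A)" if "A \<in> finite_borel" for A
    using G that by (auto simp: gaussian_random_measure_def)
  have incr: "AE \<omega> in M. X t \<omega> - X s \<omega> = M0 {s<..t} \<omega>" if "0 \<le> s" "s \<le> t" for s t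
  proof -
    have "{0..s} \<union> {s<..t} = {0..t}"
      using that by auto
    moreover have "AE \<omega> in M. M0 ({0..s} \<union> {s<..t}) \<omega> = M0 {0..s} \<omega> + M0 {s<..t} \<omega>"
      using that by (intro gaussian_random_measure_union[OF G] fin) auto
    ultimately have "AE \<omega> in M. M0 {0..t} \<omega> = M0 {0..s} \<omega> + M0 {s<..t} \<omega>"
      by simp
    with eq[OF that(1)] eq[OF order_trans[OF that]] show ?thesis
      by eventually_elim simp
  qed
  have "AE \<omega> in M. M0 {0..0} \<omega> = 0"
    using N[OF fin(1)[of 0 0]] by (simp add: normal_rv_def)
  with eq[OF order_refl] show "AE \<omega> in M. X 0 \<omega> = 0"
    by eventually_elim simp
  show "normal_rv M (\<lambda>\<omega>. X t \<omega> - X s \<omega>) 0 (t - s)" if "0 \<le> s \<and> s < t" for s t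
  proof (rule normal_rv_AE_cong)
    show "normal_rv M (M0 {s<..t}) 0 (t - s)"
      using N[OF fin(2)[of s t]] that by simp
  qed (use that in \<open>auto intro!: incr borel_measurable_diff Xm\<close>)
  show "indep_vars (\<lambda>_. borel) (\<lambda>i \<omega>. X (s (Suc i)) \<omega> - X (s i) \<omega>) {..<n}"
    if s: "0 \<le> s 0 \<and> (\<forall>i<n. s i < s (Suc i))" for n s
  proof (rule indep_vars_AE_cong)
    have mono: "s i \<le> s j" if "i \<le> j" "j \<le> n" for i j
      using that
    proof (induction j rule: dec_induct)
      case (step k)
      then have "s i \<le> s k" "s k < s (Suc k)"
        using s by auto
      then show ?case
        by simp
    qed simp
    have disj: "disjoint_family_on (\<lambda>i. {s i<..s (Suc i)}) {..<n}"
    unfolding disjoint_family_on_def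
    proof (intro ballI impI)
      have "{s i<..s (Suc i)} \<inter> {s j<..s (Suc j)} = {}" if "i < j" "j < n" for i j
        using mono[of "Suc i" j] that by auto
      then show "{s i<..s (Suc i)} \<inter> {s j<..s (Suc j)} = {}"
        if "i \<in> {..<n}" "j \<in> {..<n}" "i \<noteq> j" for i j
        using that by (metis Int_commute lessThan_iff linorder_neqE_nat)
    qed
    have "{s i<..s (Suc i)} \<in> finite_borel" if "i < n" for i
      using s that by (intro fin) (auto intro: less_imp_le)
    with disj show "indep_vars (\<lambda>_. borel) (\<lambda>i. M0 {s i<..s (Suc i)}) {..<n}"
      using G unfolding gaussian_random_measure_def by auto
    show "AE \<omega> in M. X (s (Suc i)) \<omega> - X (s i) \<omega> = M0 {s i<..s (Suc i)} \<omega>" if "i \<in> {..<n}" for i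
      using that mono[of 0 i] mono[of i "Suc i"] s by (intro incr) auto
  qed (auto intro!: borel_measurable_diff Xm)
  show "AE \<omega> in M. continuous_on {0..} (\<lambda>t. X t \<omega>)"
    using X by (auto simp: continuous_version_def intro!: AE_I2 intro: continuous_on_subset)
qed

section \<open>The process at the hitting times\<close>

theorem proposition5p1:
  fixes M :: "'w measure"
    and Y :: "real \<Rightarrow> 'w \<Rightarrow> real"
    and M0 :: "real set \<Rightarrow> 'w \<Rightarrow> real"
    and X :: "real \<Rightarrow> 'w \<Rightarrow> real"
    and H c :: real
  assumes "prob_space M"
    and "fractional_brownian_motion M H c Y"
    and "\<forall>\<omega>\<in>space M. continuous_on {0..} (\<lambda>t. Y t \<omega>)"
    and "\<forall>\<omega>\<in>space M. Y 0 \<omega> = 0"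
    and "gaussian_random_measure M M0"
    and "independent_of_process M M0 Y"
    and "continuous_version M M0 X"
  shows "(\<forall>s\<ge>0. AE \<omega> in M. hitting_time Y s \<omega> < \<infinity>) \<and>
    brownian_motion M (at_hitting_times (random_time_process X Y) Y)"
proof -
  interpret prob_space M
    by (rule assms(1))
  have cont: "continuous_on {0..} (\<lambda>t. Y t \<omega>)" and Y0: "Y 0 \<omega> = 0" if "\<omega> \<in> space M" for \<omega>
    using assms(3,4) that by auto
  have Ym: "Y t \<in> borel_measurable M" if "0 \<le> t" for t
    using fbm_linear_combination[OF assms(2) that that, of 1 0] by (simp add: normal_rv_def)
  have Xm: "X t \<in> borel_measurable M" for t
    using assms(7) by (simp add: continuous_version_def)
  \<comment> \<open>A single null set serves all levels at once: integer bounds \<open>K\<close> suffice, and the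
    intermediate value theorem fills in the real levels.\<close>
  have "AE \<omega> in M. \<forall>K::nat. \<exists>i::nat. real K < Y (real i) \<omega>"
    unfolding AE_all_countable using fbm_unbounded_above[OF assms(2)] by blast
  with AE_space have reach: "AE \<omega> in M. \<omega> \<in> space M \<and> (\<forall>s\<ge>0. \<exists>u\<ge>0. Y u \<omega> = s)"
  proof eventually_elim
    case (elim \<omega>)
    have "\<exists>u\<ge>0. Y u \<omega> = s" if "0 \<le> s" for s
    proof -
      obtain K :: nat where "s \<le> K"
        using real_arch_simple by blast
      moreover obtain i :: nat where "K < Y i \<omega>"
        using elim by blast
      ultimately show ?thesis
        using level_reached_below[OF cont[OF elim(1)], of s i] Y0[OF elim(1)] that by auto
    qed
    with elim show ?case
      by blast
  qed
  have "AE \<omega> in M. hitting_time Y s \<omega> < \<infinity>" if "0 \<le> s" for s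
    using reach
  proof eventually_elim
    case (elim \<omega>)
    with that show ?case
      by (intro hitting_time_attained(1) cont) auto
  qed
  moreover have "brownian_motion M (at_hitting_times (random_time_process X Y) Y)"
  proof (rule brownian_motion_indistinguishable)
    show "brownian_motion M X"
      by (rule continuous_version_brownian_motion[OF assms(5,7)])
    show "at_hitting_times (random_time_process X Y) Y t \<in> borel_measurable M" if "0 \<le> t" for t
      using that by (intro at_hitting_times_measurable Ym Xm cont Y0)
    show "AE \<omega> in M. \<forall>t\<ge>0. at_hitting_times (random_time_process X Y) Y t \<omega> = X t \<omega>"
      using reach by eventually_elim (auto simp: at_hitting_times_random_time[OF cont Y0])
  qed
  ultimately show ?thesis
    by blast
qed

end
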